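(* Let $P_n$ be the path on $n$ vertices rooted at a leaf (for $n=1$, rooted at its only vertex). Then for any local amoeba $G$ with a leaf, the comb product $G*P_n$ is a local amoeba.
   Context: All graphs are finite and simple; a leaf is a vertex of degree $1$. A labeled graph $G$ comes with a bijection $\lambda:V(G)\to X$ onto a label set $X$; write $v_x=\lambda^{-1}(x)$ and $L_G=\{ij: v_iv_j\in E(G)\}$ (unordered pairs). For $\sigma\in\operatorname{Sym}(X)$, $G_\sigma$ is the graph on $V(G)$ with edge set $\{v_iv_j:\sigma(i)\sigma(j)\in L_G\}$. $\operatorname{Aut}(G)$ is identified with $\{\sigma\in\operatorname{Sym}(X): G_\sigma=G\}$. An edge-replacement $rs\to kl$ removes an edge $v_rv_s\in E(G)$ and adds $v_kv_l\in E(\overline G)\cup\{v_rv_s\}$; it is feasible if $G-v_rv_s+v_kv_l\cong G$. $R_G$ is the set of feasible edge-replacements $rs\to kl$ with $rs\ne kl$ together with the neutral replacement $\emptyset\to\emptyset$ (nothing changes). $\operatorname{Fer}_G(rs\to kl)=\{\sigma\in\operatorname{Sym}(X): G_\sigma=G-v_rv_s+v_kv_l\}$ and $\operatorname{Fer}_G(\emptyset\to\emptyset)=\operatorname{Aut}(G)$. $\mathcal{E}_G$ is the union of the sets $\operatorname{Fer}_G(e\to e')$ over all $e\to e'\in R_G$, and $\operatorname{Fer}(G)=\langle\mathcal{E}_G\rangle\le\operatorname{Sym}(X)$. $G$ is a local amoeba if $\operatorname{Fer}(G)=\operatorname{Sym}(X)$. Comb product: for a graph $G$ and a graph $H$ with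 root $v$, $G*H$ has vertex set $V(G)\times V(H)$, with an edge between $(u,v)$ and $(u',v)$ for each $uu'\in E(G)$, and an edge between $(u,w)$ and $(u,w')$ for each $u\in V(G)$ and $ww'\in E(H)$. *)

theory Defs
  imports
    "Graph_Theory.Pair_Digraph"
    "Graph_Theory.Digraph_Isomorphism"
    "HOL-Algebra.Bij"
    "HOL-Algebra.Generated_Groups"
begin

text \<open>
  A finite simple graph is a \<open>pair_graph\<close>: an undirected edge \<open>uv\<close> is the pair of opposite
  arcs \<open>(u, v)\<close>, \<open>(v, u)\<close>, and an edge set is a symmetric irreflexive relation.
\<close>

definition leaf :: "'a pair_pre_digraph \<Rightarrow> 'a \<Rightarrow> bool" where
  "leaf G v \<longleftrightarrow> v \<in> pverts G \<and> out_degree (with_proj G) v = 1"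

definition path_graph :: "nat \<Rightarrow> nat pair_pre_digraph" where
  "path_graph n =
    \<lparr>pverts = {1..n},
     parcs = {(i, j). i \<in> {1..n} \<and> j \<in> {1..n} \<and> (j = i + 1 \<or> i = j + 1)}\<rparr>"

definition comb_product ::
    "'a pair_pre_digraph \<Rightarrow> 'b pair_pre_digraph \<Rightarrow> 'b \<Rightarrow> ('a \<times> 'b) pair_pre_digraph" where
  "comb_product G H v =
    \<lparr>pverts = pverts G \<times> pverts H,
     parcs = {((u, v), (u', v)) | u u'. (u, u') \<in> parcs G}
           \<union> {((u, w), (u, w')) | u w w'. u \<in> pverts G \<and> (w, w') \<in> parcs H}\<rparr>"

text \<open>The graph \<open>G - ab + cd\<close>; the edge is removed first, so \<open>G - ab + ab = G\<close> for an edge \<open>ab\<close>.\<close>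

definition replace_edge ::
    "'a pair_pre_digraph \<Rightarrow> 'a \<Rightarrow> 'a \<Rightarrow> 'a \<Rightarrow> 'a \<Rightarrow> 'a pair_pre_digraph" where
  "replace_edge G a b c d =
    \<lparr>pverts = pverts G, parcs = (parcs G - {(a, b), (b, a)}) \<union> {(c, d), (d, c)}\<rparr>"

text \<open>
  \<open>Replace r s k l\<close> is the replacement \<open>rs \<rightarrow> kl\<close> of unordered pairs of labels; it is represented
  by each of the four orderings, all of which have the same effect. \<open>Neutral\<close> is
  \<open>\<emptyset> \<rightarrow> \<emptyset>\<close>.
\<close>

datatype 'b replacement = Neutral | Replace 'b 'b 'b 'b

locale labeled_graph = pair_graph G for G :: "'a pair_pre_digraph" +
  fixes lab :: "'a \<Rightarrow> 'b" and X :: "'b set"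
  assumes bij_lab: "bij_betw lab (pverts G) X"
begin

definition vert :: "'b \<Rightarrow> 'a" where
  "vert x = inv_into (pverts G) lab x"

definition label_edges :: "'b rel" where
  "label_edges = {(i, j). i \<in> X \<and> j \<in> X \<and> (vert i, vert j) \<in> parcs G}"

text \<open>
  \<open>Sym(X)\<close> is \<^const>\<open>BijGroup\<close>, whose elements are the bijections of \<open>X\<close>, made unique as total
  functions by being \<^const>\<open>undefined\<close> outside \<open>X\<close>.
\<close>

definition permuted :: "('b \<Rightarrow> 'b) \<Rightarrow> 'a pair_pre_digraph" where
  "permuted \<sigma> =
    \<lparr>pverts = pverts G,
     parcs = {(vert i, vert j) | i j. i \<in> X \<and> j \<in> X \<and> (\<sigma> i, \<sigma> j) \<in> label_edges}\<rparr>"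

definition Aut :: "('b \<Rightarrow> 'b) set" where
  "Aut = {\<sigma> \<in> carrier (BijGroup X). permuted \<sigma> = G}"

definition edge_replacement :: "'b \<Rightarrow> 'b \<Rightarrow> 'b \<Rightarrow> 'b \<Rightarrow> bool" where
  "edge_replacement r s k l \<longleftrightarrow>
     r \<in> X \<and> s \<in> X \<and> k \<in> X \<and> l \<in> X \<and> (vert r, vert s) \<in> parcs G \<and>
     (k \<noteq> l \<and> (vert k, vert l) \<notin> parcs G \<or> {k, l} = {r, s})"

definition feasible :: "'b \<Rightarrow> 'b \<Rightarrow> 'b \<Rightarrow> 'b \<Rightarrow> bool" where
  "feasible r s k l \<longleftrightarrow>
     edge_replacement r s k l \<and>
     digraph_iso (with_proj (replace_edge G (vert r) (vert s) (vert k) (vert l))) (with_proj G)"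

definition feasible_replacements :: "'b replacement set" where
  "feasible_replacements =
     {Neutral} \<union> {Replace r s k l | r s k l. feasible r s k l \<and> {r, s} \<noteq> {k, l}}"

fun Fer :: "'b replacement \<Rightarrow> ('b \<Rightarrow> 'b) set" where
  "Fer Neutral = Aut"
| "Fer (Replace r s k l) =
     {\<sigma> \<in> carrier (BijGroup X).
        permuted \<sigma> = replace_edge G (vert r) (vert s) (vert k) (vert l)}"

definition Fer_generators :: "('b \<Rightarrow> 'b) set" where
  "Fer_generators = (\<Union>\<rho> \<in> feasible_replacements. Fer \<rho>)"

definition Fer_group :: "('b \<Rightarrow> 'b) set" where
  "Fer_group = generate (BijGroup X) Fer_generators"

end

definition local_amoeba :: "'a pair_pre_digraph \<Rightarrow> ('a \<Rightarrow> 'b) \<Rightarrow> 'b set \<Rightarrow> bool" where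
  "local_amoeba G lab X \<longleftrightarrow>
     labeled_graph G lab X \<and> labeled_graph.Fer_group G lab X = carrier (BijGroup X)"

end

theory Submission
  imports Defs
begin

text \<open>
  A permutation lies in a set \<open>Fer\<close> iff it pulls the edge set back into the edge set plus at most
  one edge. Permutations of \<open>V(G)\<close> with this property lift to \<open>G * P\<^sub>n\<close>, acting on the first
  coordinate. Let \<open>x\<close> be a leaf of \<open>G\<close> with neighbour \<open>y\<close>. In \<open>G * P\<^sub>n\<close> the vertex \<open>(y, 1)\<close>
  carries two hanging paths, \<open>(x, 1), \<dots>, (x, n)\<close> and \<open>(y, 2), \<dots>, (y, n)\<close>. Reversing a final
  segment of the first one replaces one edge, and so does exchanging the first \<open>n - 1\<close> vertices of
  the first path with the second path. The reversals give all transpositions inside the fibre of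
  \<open>x\<close>, the exchange then gives a transposition between the fibres of \<open>x\<close> and \<open>y\<close>, and conjugation
  with the lifted permutations gives all transpositions.
\<close>

section \<open>Edge-replacing permutations of the vertex set\<close>

text \<open>For finite \<open>G\<close> the pullback has as many arcs as \<open>G\<close>, so
  bounding it from above by \<open>G\<close> plus one pair already forces that at most one edge is
  exchanged; the removed edge need not be named. Automorphisms are included, since
  \<open>c d\<close> may be an edge and \<open>c = d\<close> is allowed.\<close>

definition edge_switch :: "'a pair_pre_digraph \<Rightarrow> ('a \<Rightarrow> 'a) \<Rightarrow> bool" where
  "edge_switch G p \<longleftrightarrow> p permutes pverts G \<and>
     (\<exists>c d. \<forall>a b. (p a, p b) \<in> parcs G \<longrightarrow> (a, b) \<in> parcs G \<union> {(c, d), (d, c)})"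

text \<open>The rules mirror \<open>generate\<close>, but on total functions fixing everything
  outside \<open>pverts G\<close>. Plain composition and \<open>inv_into UNIV\<close> then replace
  the operations on extensional maps in \<open>BijGroup\<close>.\<close>

inductive_set switch_group :: "'a pair_pre_digraph \<Rightarrow> ('a \<Rightarrow> 'a) set" for G where
  one: "id \<in> switch_group G"
| incl: "edge_switch G p \<Longrightarrow> p \<in> switch_group G"
| inv: "edge_switch G p \<Longrightarrow> inv_into UNIV p \<in> switch_group G"
| comp: "p \<in> switch_group G \<Longrightarrow> q \<in> switch_group G \<Longrightarrow> p \<circ> q \<in> switch_group G"

lemma switch_group_permutes: "p \<in> switch_group G \<Longrightarrow> p permutes pverts G"
  by (induction rule: switch_group.induct)
    (blast intro: permutes_id permutes_inv permutes_compose dest: edge_switch_def[THEN iffD1])+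

text \<open>The rule \<open>inv\<close> covers generators only; inversion reverses a composition,
  which extends it to the whole set.\<close>

lemma switch_group_inv: "p \<in> switch_group G \<Longrightarrow> inv_into UNIV p \<in> switch_group G"
proof (induction rule: switch_group.induct)
  case (inv p)
  then show ?case
    by (metis edge_switch_def permutes_inv_inv switch_group.incl)
next
  case (comp p q)
  then have "bij p" "bij q"
    by (auto dest: switch_group_permutes permutes_bij)
  then show ?case
    using switch_group.comp[OF comp.IH(2,1)] by (simp only: o_inv_distrib)
qed (simp_all only: inv_id switch_group.one switch_group.inv)

text \<open>For an involution pulling back and pushing forward agree, so it suffices to follow the
  arcs of \<open>G\<close> forward, which permits a case analysis over arcs.\<close>

lemma edge_switch_involutionI:
  assumes "\<And>a. p (p a) = a" "\<And>a. a \<notin> pverts G \<Longrightarrow> p a = a"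
    and "\<And>a b. (a, b) \<in> parcs G \<Longrightarrow> (p a, p b) \<in> parcs G \<union> {(c, d), (d, c)}"
  shows "edge_switch G p"
proof -
  have "p permutes pverts G"
    unfolding permutes_def using assms(1,2) by metis
  moreover have "(a, b) \<in> parcs G \<union> {(c, d), (d, c)}" if "(p a, p b) \<in> parcs G" for a b
    using assms(3)[OF that] by (simp add: assms(1))
  ultimately show ?thesis
    unfolding edge_switch_def by blast
qed

text \<open>Conjugation by a graph isomorphism turns a switch with new pair \<open>c d\<close> into
  one with new pair \<open>f c\<close>, \<open>f d\<close>. The map \<open>f\<close> is a bijection
  of the whole type, so that the conjugate fixes all points outside \<open>pverts H\<close>.\<close>

lemma switch_group_transport:
  assumes f: "bij f" "pverts H = f ` pverts G" "parcs H = map_prod f f ` parcs G"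
    and p: "p \<in> switch_group G"
  shows "f \<circ> p \<circ> inv_into UNIV f \<in> switch_group H"
proof -
  have inv_f: "inv_into UNIV f (f a) = a" "f (inv_into UNIV f b) = b" for a b
    using f(1) by (simp_all add: bij_is_inj bij_is_surj surj_f_inv_f)
  have arcs: "(f a, f b) \<in> parcs H \<longleftrightarrow> (a, b) \<in> parcs G" for a b
    using f(1) by (auto simp: f(3) bij_def dest: injD)
  have switch: "edge_switch H (f \<circ> p \<circ> inv_into UNIV f)" if p: "edge_switch G p" for p
  proof -
    obtain c d where cd: "\<And>a b. (p a, p b) \<in> parcs G \<Longrightarrow> (a, b) \<in> parcs G \<union> {(c, d), (d, c)}"
      using p unfolding edge_switch_def by blast
    have bij: "bij p"
      using p unfolding edge_switch_def by (blast dest: permutes_bij)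
    have "f \<circ> p \<circ> inv_into UNIV f permutes pverts H"
    proof (rule bij_imp_permutes)
      show "bij_betw (f \<circ> p \<circ> inv_into UNIV f) (pverts H) (pverts H)"
      proof (intro bij_betw_trans)
        show "bij_betw (inv_into UNIV f) (pverts H) (pverts G)"
        proof (rule bij_betw_imageI)
          show "inj_on (inv_into UNIV f) (pverts H)"
            using inv_f(2) by (rule inj_on_inverseI)
          show "inv_into UNIV f ` pverts H = pverts G"
            by (simp add: f(2) image_image inv_f)
        qed
        show "bij_betw p (pverts G) (pverts G)"
          using p unfolding edge_switch_def by (blast dest: permutes_imp_bij)
        show "bij_betw f (pverts G) (pverts H)"
          unfolding f(2) using bij_betw_subset[OF f(1) subset_UNIV refl] .
      qed
      show "(f \<circ> p \<circ> inv_into UNIV f) x = x" if "x \<notin> pverts H" for x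
      proof -
        have "inv_into UNIV f x \<notin> pverts G"
          using that inv_f(2)[of x] f(2) by force
        then have "p (inv_into UNIV f x) = inv_into UNIV f x"
          using p unfolding edge_switch_def by (blast dest: permutes_not_in)
        then show ?thesis by (simp add: inv_f)
      qed
    qed
    moreover have "(a, b) \<in> parcs H \<union> {(f c, f d), (f d, f c)}"
      if "((f \<circ> p \<circ> inv_into UNIV f) a, (f \<circ> p \<circ> inv_into UNIV f) b) \<in> parcs H" for a b
    proof -
      have "(inv_into UNIV f a, inv_into UNIV f b) \<in> parcs G \<union> {(c, d), (d, c)}"
        using that by (intro cd) (simp add: arcs)
      then show ?thesis
        using arcs[of "inv_into UNIV f a" "inv_into UNIV f b"] by (auto simp: inv_f)
    qed
    ultimately show ?thesis
      unfolding edge_switch_def by blast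
  qed
  show ?thesis
    using p
  proof (induction rule: switch_group.induct)
    case one
    then show ?case
      using switch_group.one[of H] by (simp add: fun_eq_iff id_def inv_f comp_def)
  next
    case (incl p)
    then show ?case by (intro switch_group.incl switch)
  next
    case (inv p)
    have "bij p"
      using inv unfolding edge_switch_def by (blast dest: permutes_bij)
    then have "inv_into UNIV (f \<circ> p \<circ> inv_into UNIV f) = f \<circ> inv_into UNIV p \<circ> inv_into UNIV f"
      using f(1) by (simp add: o_inv_distrib bij_comp bij_imp_bij_inv inv_inv_eq comp_assoc)
    then show ?case
      using switch_group.inv[OF switch[OF inv]] by (simp only:)
  next
    case (comp p q)
    have "(f \<circ> p \<circ> inv_into UNIV f) \<circ> (f \<circ> q \<circ> inv_into UNIV f) = f \<circ> (p \<circ> q) \<circ> inv_into UNIV f"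
      by (simp add: fun_eq_iff inv_f)
    then show ?case
      using switch_group.comp[OF comp.IH] by (simp only:)
  qed
qed

section \<open>Transpositions in the switch group\<close>

lemma transpose_conj:
  assumes "bij p"
  shows "p \<circ> transpose a b \<circ> inv_into UNIV p = transpose (p a) (p b)"
proof
  fix x
  show "(p \<circ> transpose a b \<circ> inv_into UNIV p) x = transpose (p a) (p b) x"
    using transpose_apply_commute[OF assms, of "p a" "p b" "inv_into UNIV p x"] assms
    by (simp add: bij_is_inj bij_is_surj surj_f_inv_f)
qed

lemma transpose_switch_group_image:
  assumes "p \<in> switch_group G" "transpose a b \<in> switch_group G"
  shows "transpose (p a) (p b) \<in> switch_group G"
proof -
  have "p \<circ> transpose a b \<circ> inv_into UNIV p \<in> switch_group G"
    using assms by (intro switch_group.comp switch_group_inv)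
  then show ?thesis
    using transpose_conj[OF permutes_bij[OF switch_group_permutes[OF assms(1)]]] by (simp only:)
qed

lemma transpose_switch_group_trans:
  assumes "transpose a b \<in> switch_group G" "transpose b c \<in> switch_group G"
  shows "transpose a c \<in> switch_group G"
proof (cases "a = b \<or> a = c")
  case True
  then show ?thesis
    using assms by (auto intro: switch_group.one)
next
  case False
  then show ?thesis
    \<comment> \<open>Conjugation by \<open>transpose b c\<close> keeps \<open>a\<close> and moves
      \<open>b\<close> to \<open>c\<close>.\<close>
    using transpose_switch_group_image[OF assms(2,1)] by simp
qed

lemma switch_group_full:
  assumes "finite (pverts G)"
    and "\<And>a b. a \<in> pverts G \<Longrightarrow> b \<in> pverts G \<Longrightarrow> transpose a b \<in> switch_group G"
    and "p permutes pverts G"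
  shows "p \<in> switch_group G"
  using assms(3,1)
  by (induction rule: permutes_induct) (blast intro: switch_group.one switch_group.comp assms(2))+

section \<open>Local amoebas in terms of vertex permutations\<close>

text \<open>Equal cardinality makes \<open>E - E'\<close> and \<open>E' - E\<close> equally large.
  The latter consists of the two arcs of \<open>cd\<close>, so the former has two elements and, by
  symmetry, is a pair of opposite arcs. This recovers the removed edge from the one-sided bound in
  \<open>edge_switch\<close>.\<close>

lemma single_edge_exchange:
  assumes E: "finite E" "sym E" "irrefl E" and E': "sym E'" "irrefl E'"
    and card: "card E' = card E" and sub: "E' \<subseteq> E \<union> {(c, d), (d, c)}" and not_sub: "\<not> E' \<subseteq> E"
  obtains r s where "(r, s) \<in> E" "(c, d) \<notin> E" "c \<noteq> d" "E' = (E - {(r, s), (s, r)}) \<union> {(c, d), (d, c)}"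
proof -
  have fin: "finite E'"
    using E(1) sub by (auto intro: finite_subset)
  have cd: "(c, d) \<in> E'" "(d, c) \<in> E'" "(c, d) \<notin> E" "(d, c) \<notin> E"
    using not_sub sub E(2) E'(1) by (auto dest: symD)
  then have "c \<noteq> d"
    using E'(2) by (auto simp: irrefl_def)
  have new: "E' - E = {(c, d), (d, c)}"
    using cd sub by auto
  have "card (E - E') = card (E' - E)"
    using card E(1) fin by (simp add: card_Diff_subset_Int Int_commute)
  then have card2: "card (E - E') = 2"
    using new \<open>c \<noteq> d\<close> by simp
  then obtain r s where rs: "(r, s) \<in> E - E'"
    by (metis card.empty equals0I zero_neq_numeral surj_pair)
  then have sr: "(s, r) \<in> E - E'" "r \<noteq> s"
    using E E' by (auto dest: symD simp: irrefl_def)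
  have "{(r, s), (s, r)} = E - E'"
    using rs sr card2 E(1) by (intro card_subset_eq) auto
  then have "E' = (E - {(r, s), (s, r)}) \<union> {(c, d), (d, c)}"
    using new by blast
  then show ?thesis
    using that rs cd(3) \<open>c \<noteq> d\<close> by blast
qed

section \<open>Translation between label permutations and vertex permutations\<close>

context labeled_graph
begin

lemma vert_lab: "a \<in> pverts G \<Longrightarrow> vert (lab a) = a"
  using bij_lab unfolding vert_def by (simp add: bij_betw_inv_into_left)

lemma lab_vert: "x \<in> X \<Longrightarrow> lab (vert x) = x"
  using bij_lab unfolding vert_def by (simp add: bij_betw_inv_into_right)

lemma vert_in: "x \<in> X \<Longrightarrow> vert x \<in> pverts G"
  using bij_lab unfolding vert_def by (metis bij_betw_def inv_into_into)

lemma lab_in: "a \<in> pverts G \<Longrightarrow> lab a \<in> X"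
  using bij_lab by (auto simp: bij_betw_def)

text \<open>Conjugation by the labeling, restricted to \<open>X\<close> because elements of
  \<open>BijGroup X\<close> are extensional. The following lemmas make it a group isomorphism from
  the permutations of \<open>pverts G\<close> onto \<open>BijGroup X\<close>.\<close>

definition label_perm :: "('a \<Rightarrow> 'a) \<Rightarrow> 'b \<Rightarrow> 'b" where
  "label_perm p = (\<lambda>x\<in>X. lab (p (vert x)))"

lemma label_perm_carrier:
  assumes "p permutes pverts G"
  shows "label_perm p \<in> carrier (BijGroup X)"
proof -
  have "bij_betw vert X (pverts G)"
    using bij_lab unfolding vert_def[abs_def] by (rule bij_betw_inv_into)
  then have "bij_betw (lab \<circ> (p \<circ> vert)) X X"
    using bij_lab permutes_imp_bij[OF assms] by (intro bij_betw_trans)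
  then have "bij_betw (label_perm p) X X"
    by (rule bij_betw_cong[THEN iffD1, rotated]) (simp add: label_perm_def)
  then show ?thesis
    by (simp add: BijGroup_def Bij_def label_perm_def)
qed

lemma label_perm_comp:
  assumes "p permutes pverts G" "q permutes pverts G"
  shows "label_perm (p \<circ> q) = label_perm p \<otimes>\<^bsub>BijGroup X\<^esub> label_perm q"
  using label_perm_carrier[OF assms(1)] label_perm_carrier[OF assms(2)] assms
  by (auto simp: BijGroup_def compose_def label_perm_def fun_eq_iff vert_lab vert_in lab_in
      permutes_in_image)

lemma label_perm_id: "label_perm id = \<one>\<^bsub>BijGroup X\<^esub>"
  by (auto simp: BijGroup_def label_perm_def fun_eq_iff lab_vert)

lemma label_perm_inv:
  assumes "p permutes pverts G"
  shows "label_perm (inv_into UNIV p) = inv\<^bsub>BijGroup X\<^esub> label_perm p"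
proof -
  have "label_perm (inv_into UNIV p) \<otimes>\<^bsub>BijGroup X\<^esub> label_perm p = \<one>\<^bsub>BijGroup X\<^esub>"
    using assms by (simp add: permutes_inv permutes_inv_o label_perm_id flip: label_perm_comp)
  then show ?thesis
    using assms by (intro group.inv_equality[OF group_BijGroup, symmetric])
      (auto intro: label_perm_carrier permutes_inv)
qed

lemma label_perm_surj:
  assumes "\<sigma> \<in> carrier (BijGroup X)"
  obtains p where "p permutes pverts G" "label_perm p = \<sigma>"
proof
  let ?p = "\<lambda>a. if a \<in> pverts G then vert (\<sigma> (lab a)) else a"
  have \<sigma>: "bij_betw \<sigma> X X" "\<sigma> \<in> extensional X"
    using assms by (auto simp: BijGroup_def Bij_def)
  have "bij_betw vert X (pverts G)"
    using bij_lab unfolding vert_def[abs_def] by (rule bij_betw_inv_into)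
  then have "bij_betw (vert \<circ> (\<sigma> \<circ> lab)) (pverts G) (pverts G)"
    using bij_lab \<sigma>(1) by (intro bij_betw_trans)
  then have "bij_betw ?p (pverts G) (pverts G)"
    by (rule bij_betw_cong[THEN iffD1, rotated]) simp
  then show "?p permutes pverts G"
    by (rule bij_imp_permutes) simp
  show "label_perm ?p = \<sigma>"
  proof
    fix x show "label_perm ?p x = \<sigma> x"
    proof (cases "x \<in> X")
      case True
      then have "\<sigma> x \<in> X"
        using \<sigma>(1) by (blast dest: bij_betwE)
      with True show ?thesis
        by (simp add: label_perm_def vert_in lab_vert)
    qed (simp add: label_perm_def extensional_arb[OF \<sigma>(2)])
  qed
qed

lemma label_perm_inj:
  assumes "p permutes pverts G" "q permutes pverts G" "label_perm p = label_perm q"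
  shows "p = q"
proof
  fix a
  show "p a = q a"
  proof (cases "a \<in> pverts G")
    case True
    then have "lab (p a) = lab (q a)"
      using fun_cong[OF assms(3), of "lab a"] by (simp add: label_perm_def lab_in vert_lab)
    then show ?thesis
      using True assms(1,2) by (metis permutes_in_image vert_lab)
  qed (use assms in \<open>simp add: permutes_not_in\<close>)
qed

text \<open>The inverse maps \<open>lab\<close> and \<open>vert\<close> cancel, which turns the
  label-based definition of \<open>permuted\<close> into a pullback of the arc relation.\<close>

lemma permuted_label_perm:
  assumes "p permutes pverts G"
  shows "permuted (label_perm p) = \<lparr>pverts = pverts G, parcs = {(a, b). (p a, p b) \<in> parcs G}\<rparr>"
proof -
  have "{(vert i, vert j) | i j. i \<in> X \<and> j \<in> X \<and> (label_perm p i, label_perm p j) \<in> label_edges}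
      = {(a, b). (p a, p b) \<in> parcs G}" (is "?L = ?R")
  proof (intro equalityI subsetI)
    fix e assume "e \<in> ?L"
    then show "e \<in> ?R"
      using assms by (auto simp: label_perm_def label_edges_def vert_lab vert_in permutes_in_image)
  next
    fix e assume "e \<in> ?R"
    then obtain a b where e: "e = (a, b)" "(p a, p b) \<in> parcs G" by auto
    then have ab: "a \<in> pverts G" "b \<in> pverts G"
      using assms by (auto dest: wellformed' simp: permutes_in_image)
    then have "p a \<in> pverts G" "p b \<in> pverts G"
      using assms by (auto simp: permutes_in_image)
    then show "e \<in> ?L"
      using e ab by (intro CollectI exI[of _ "lab a"] exI[of _ "lab b"])
        (simp add: label_perm_def label_edges_def vert_lab lab_in)
  qed
  then show ?thesis
    by (simp add: permuted_def)
qed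

lemma Fer_generators_carrier: "Fer_generators \<subseteq> carrier (BijGroup X)"
  unfolding Fer_generators_def feasible_replacements_def by (auto simp: Aut_def)

text \<open>Every \<open>Fer\<close> set adds at most one edge, which gives one direction.
  Conversely, by counting arcs, a pullback inside \<open>G\<close> equals \<open>G\<close>, and any
  other one is a proper replacement, feasible because \<open>p\<close> is an isomorphism.\<close>

lemma label_perm_generator_iff:
  assumes p: "p permutes pverts G"
  shows "label_perm p \<in> Fer_generators \<longleftrightarrow> edge_switch G p"
proof
  assume "label_perm p \<in> Fer_generators"
  then obtain \<rho> where \<rho>: "\<rho> \<in> feasible_replacements" "label_perm p \<in> Fer \<rho>"
    unfolding Fer_generators_def by blast
  show "edge_switch G p"
  proof (cases \<rho>)
    case Neutral
    then have "parcs (permuted (label_perm p)) = parcs G"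
      using \<rho>(2) by (simp add: Aut_def)
    then show ?thesis
      using p by (auto simp: edge_switch_def permuted_label_perm set_eq_iff)
  next
    case (Replace r s k l)
    then have "parcs (permuted (label_perm p)) = parcs (replace_edge G (vert r) (vert s) (vert k) (vert l))"
      using \<rho>(2) by simp
    then have "{(a, b). (p a, p b) \<in> parcs G} \<subseteq> parcs G \<union> {(vert k, vert l), (vert l, vert k)}"
      using p by (auto simp: permuted_label_perm replace_edge_def)
    then show ?thesis
      using p unfolding edge_switch_def by blast
  qed
next
  assume "edge_switch G p"
  then obtain c d where cd: "{(a, b). (p a, p b) \<in> parcs G} \<subseteq> parcs G \<union> {(c, d), (d, c)}"
    unfolding edge_switch_def by blast
  define E' where "E' = {(a, b). (p a, p b) \<in> parcs G}"
  have inj: "inj (map_prod p p)"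
    using p by (simp add: permutes_inj prod.inj_map)
  \<comment> \<open>\<open>E'\<close> is the pullback of the arc set along a bijection, hence has
    the same size.\<close>
  have "map_prod p p ` E' = parcs G"
  proof (intro equalityI subsetI)
    fix e assume "e \<in> parcs G"
    then show "e \<in> map_prod p p ` E'"
      using p by (intro image_eqI[of _ _ "(inv_into UNIV p (fst e), inv_into UNIV p (snd e))"])
        (auto simp: E'_def permutes_inverses)
  qed (auto simp: E'_def)
  then have card: "card E' = card (parcs G)"
    using inj by (metis card_image inj_on_subset subset_UNIV)
  have G: "sym (parcs G)" "irrefl (parcs G)"
    by (auto intro: symI dest: arcs_symmetric) (force simp: irrefl_def dest: pair_no_loops)
  then have E': "sym E'" "irrefl E'"
    by (auto simp: E'_def sym_def irrefl_def)
  have permuted: "permuted (label_perm p) = \<lparr>pverts = pverts G, parcs = E'\<rparr>"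
    using p by (simp add: permuted_label_perm E'_def)
  show "label_perm p \<in> Fer_generators"
  proof (cases "E' \<subseteq> parcs G")
    case True
    then have "E' = parcs G"
      using card pair_finite_arcs by (intro card_subset_eq) auto
    then have "label_perm p \<in> Fer Neutral"
      using p by (simp add: Aut_def permuted label_perm_carrier)
    then show ?thesis
      unfolding Fer_generators_def feasible_replacements_def by blast
  next
    case False
    obtain r s where rs: "(r, s) \<in> parcs G" "(c, d) \<notin> parcs G" "c \<noteq> d"
        "E' = (parcs G - {(r, s), (s, r)}) \<union> {(c, d), (d, c)}"
      using single_edge_exchange[OF pair_finite_arcs G E' card _ False] cd
      unfolding E'_def[symmetric] by blast
    \<comment> \<open>\<open>edge_switch\<close> does not say that \<open>c\<close> and
      \<open>d\<close> are vertices; it follows here because the new arc is pulled back from an arc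
      of \<open>G\<close>.\<close>
    then have "(p c, p d) \<in> parcs G"
      by (auto simp: E'_def)
    then have V: "r \<in> pverts G" "s \<in> pverts G" "c \<in> pverts G" "d \<in> pverts G"
      using rs(1) p by (auto dest: wellformed' simp: permutes_in_image)
    have H: "replace_edge G r s c d = \<lparr>pverts = pverts G, parcs = E'\<rparr>"
      using rs(4) by (simp add: replace_edge_def)
    let ?H = "with_proj \<lparr>pverts = pverts G, parcs = E'\<rparr>"
    \<comment> \<open>The permutation \<open>p\<close> itself maps the modified graph isomorphically
      onto \<open>G\<close>.\<close>
    let ?f = "\<lparr>iso_verts = p, iso_arcs = map_prod p p, iso_head = snd, iso_tail = fst\<rparr>"
    have "wf_digraph ?H"
      using p by unfold_locales (auto dest: wellformed' simp: E'_def permutes_in_image)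
    then have "pre_digraph.digraph_isomorphism ?H ?f"
      using inj p unfolding pre_digraph.digraph_isomorphism_def
      by (auto intro: inj_on_subset permutes_inj_on)
    moreover have "with_proj G = app_iso ?f ?H"
      using p \<open>map_prod p p ` E' = parcs G\<close>
      by (simp add: app_iso_def with_proj_def permutes_image)
    ultimately have "digraph_iso ?H (with_proj G)"
      unfolding digraph_iso_def by blast
    moreover have "lab c \<noteq> lab d"
      using V rs(3) by (metis vert_lab)
    ultimately have "feasible (lab r) (lab s) (lab c) (lab d)"
      using rs(1-3) V by (simp add: feasible_def edge_replacement_def vert_lab lab_in H)
    moreover have "{lab r, lab s} \<noteq> {lab c, lab d}"
    proof
      assume "{lab r, lab s} = {lab c, lab d}"
      then have "vert ` {lab r, lab s} = vert ` {lab c, lab d}"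
        by (rule arg_cong)
      then have "r = c \<and> s = d \<or> r = d \<and> s = c"
        using V by (simp add: vert_lab doubleton_eq_iff)
      then show False
        using rs(1,2) arcs_symmetric[OF rs(1)] by blast
    qed
    ultimately have "Replace (lab r) (lab s) (lab c) (lab d) \<in> feasible_replacements"
      unfolding feasible_replacements_def by blast
    moreover have "label_perm p \<in> Fer (Replace (lab r) (lab s) (lab c) (lab d))"
      using p V by (simp add: vert_lab H permuted label_perm_carrier)
    ultimately show ?thesis
      unfolding Fer_generators_def by (rule UN_I)
  qed
qed

lemma label_perm_Fer_group_iff:
  assumes p: "p permutes pverts G"
  shows "label_perm p \<in> Fer_group \<longleftrightarrow> p \<in> switch_group G"
proof
  assume "p \<in> switch_group G"
  then show "label_perm p \<in> Fer_group"
    unfolding Fer_group_def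
  proof (induction rule: switch_group.induct)
    case one
    then show ?case by (simp only: label_perm_id generate.one)
  next
    case (incl p)
    then show ?case
      by (metis edge_switch_def label_perm_generator_iff generate.incl)
  next
    case (inv p)
    then show ?case
      by (metis edge_switch_def label_perm_generator_iff label_perm_inv generate.inv)
  next
    case (comp p q)
    then show ?case
      by (metis label_perm_comp switch_group_permutes generate.eng)
  qed
next
  assume "label_perm p \<in> Fer_group"
  \<comment> \<open>The induction yields only some preimage \<open>q\<close> of a group element;
    injectivity of \<open>label_perm\<close> later identifies it with \<open>p\<close>.\<close>
  moreover have "\<exists>q \<in> switch_group G. label_perm q = \<sigma>" if "\<sigma> \<in> Fer_group" for \<sigma>
    using that unfolding Fer_group_def
  proof (induction rule: generate.induct)
    case one
    then show ?case
      using label_perm_id switch_group.one by blast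
  next
    case (incl \<sigma>)
    then have "\<sigma> \<in> carrier (BijGroup X)"
      using Fer_generators_carrier by blast
    then obtain q where "q permutes pverts G" "label_perm q = \<sigma>"
      by (rule label_perm_surj)
    then show ?case
      using incl label_perm_generator_iff switch_group.incl by blast
  next
    case (inv \<sigma>)
    then have "\<sigma> \<in> carrier (BijGroup X)"
      using Fer_generators_carrier by blast
    then obtain q where "q permutes pverts G" "label_perm q = \<sigma>"
      by (rule label_perm_surj)
    then show ?case
      using inv label_perm_generator_iff label_perm_inv switch_group.inv by blast
  next
    case (eng \<sigma> \<tau>)
    then show ?case
      using label_perm_comp switch_group_permutes switch_group.comp by metis
  qed
  ultimately obtain q where "q \<in> switch_group G" "label_perm q = label_perm p"
    by blast
  then show "p \<in> switch_group G"
    using p label_perm_inj switch_group_permutes by blast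
qed

end

text \<open>Beyond the requirement that \<open>lab\<close> is a labeling, the condition is free of
  labels, so the rest of the argument works with vertices alone.\<close>

lemma local_amoeba_iff:
  "local_amoeba G lab X \<longleftrightarrow>
     labeled_graph G lab X \<and> (\<forall>p. p permutes pverts G \<longrightarrow> p \<in> switch_group G)"
proof (cases "labeled_graph G lab X")
  case True
  interpret labeled_graph G lab X by fact
  have "Fer_group \<subseteq> carrier (BijGroup X)"
    unfolding Fer_group_def
    using group.generate_incl[OF group_BijGroup Fer_generators_carrier] .
  then have "Fer_group = carrier (BijGroup X) \<longleftrightarrow> carrier (BijGroup X) \<subseteq> Fer_group"
    by blast
  also have "\<dots> \<longleftrightarrow> (\<forall>p. p permutes pverts G \<longrightarrow> label_perm p \<in> Fer_group)"
    using label_perm_carrier by (auto elim!: label_perm_surj)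
  also have "\<dots> \<longleftrightarrow> (\<forall>p. p permutes pverts G \<longrightarrow> p \<in> switch_group G)"
    using label_perm_Fer_group_iff by blast
  finally show ?thesis
    using True by (simp add: local_amoeba_def)
qed (simp add: local_amoeba_def)

section \<open>Comb products with paths\<close>

lemma leaf_unique_neighbour:
  assumes "leaf G x"
  obtains y where "\<And>u. (x, u) \<in> parcs G \<longleftrightarrow> u = y"
proof -
  have "card {e \<in> parcs G. fst e = x} = 1"
    using assms by (simp add: leaf_def out_degree_def out_arcs_def)
  then obtain e where e: "{e \<in> parcs G. fst e = x} = {e}"
    by (auto simp: card_1_singleton_iff)
  then have "fst e = x"
    by blast
  then have "(x, u) \<in> parcs G \<longleftrightarrow> u = snd e" for u
    using e by (cases e) (auto simp: set_eq_iff)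
  then show ?thesis by (rule that)
qed

text \<open>An interior vertex has the two distinct neighbours \<open>r - 1\<close> and
  \<open>r + 1\<close>, so only the ends can be leaves.\<close>

lemma leaf_path_graphD:
  assumes "leaf (path_graph n) r"
  shows "r = 1 \<or> r = n"
proof (rule ccontr)
  assume r: "\<not> (r = 1 \<or> r = n)"
  obtain y where y: "\<And>u. (r, u) \<in> parcs (path_graph n) \<longleftrightarrow> u = y"
    using leaf_unique_neighbour[OF assms] by blast
  have "r \<in> {1..n}"
    using assms by (simp add: leaf_def path_graph_def)
  then have "(r, r - 1) \<in> parcs (path_graph n)" "(r, r + 1) \<in> parcs (path_graph n)"
    using r by (auto simp: path_graph_def)
  then show False
    using \<open>r \<in> {1..n}\<close> unfolding y by simp
qed

lemma pverts_comb_path: "pverts (comb_product G (path_graph n) r) = pverts G \<times> {1..n}"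
  by (simp add: comb_product_def path_graph_def)

lemma parcs_comb_path:
  "((u, i), (v, j)) \<in> parcs (comb_product G (path_graph n) r) \<longleftrightarrow>
     i = r \<and> j = r \<and> (u, v) \<in> parcs G \<or>
     u = v \<and> u \<in> pverts G \<and> i \<in> {1..n} \<and> j \<in> {1..n} \<and> (j = i + 1 \<or> i = j + 1)"
  by (auto simp: comb_product_def path_graph_def)

lemma parcs_comb_path_cases:
  assumes "(a, b) \<in> parcs (comb_product G (path_graph n) r)"
  obtains (base) u v where "a = (u, r)" "b = (v, r)" "(u, v) \<in> parcs G"
  | (up) u i where "a = (u, i)" "b = (u, Suc i)" "u \<in> pverts G" "i \<in> {1..<n}"
  | (down) u i where "a = (u, Suc i)" "b = (u, i)" "u \<in> pverts G" "i \<in> {1..<n}"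
  using assms by (cases a; cases b) (auto simp: parcs_comb_path)

lemma pair_graph_comb_path:
  assumes "pair_graph G" "r \<in> {1..n}"
  shows "pair_graph (comb_product G (path_graph n) r)" (is "pair_graph ?H")
proof -
  interpret pair_graph G by fact
  have wf: "e \<in> pverts ?H \<times> pverts ?H" if "e \<in> parcs ?H" for e
    using that assms(2)
    by (cases e rule: prod.exhaust[case_product prod.exhaust])
      (auto simp: pverts_comb_path parcs_comb_path dest: wellformed')
  have fin: "finite (pverts ?H)"
    using pair_finite_verts by (simp add: pverts_comb_path)
  show ?thesis
  proof
    show "finite (parcs ?H)"
      using wf fin by (intro finite_subset[of "parcs ?H" "pverts ?H \<times> pverts ?H"]) auto
    show "symmetric (with_proj ?H)"
      unfolding symmetric_def with_proj_simps
      by (rule symI) (auto simp: parcs_comb_path dest: arcs_symmetric)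
    show "fst e \<noteq> snd e" if "e \<in> parcs ?H" for e
      using that by (cases e) (auto simp: parcs_comb_path dest: no_loops')
  qed (use wf fin in \<open>auto simp: mem_Times_iff\<close>)
qed

section \<open>Three kinds of permutations of the comb product\<close>

definition lift_perm :: "nat \<Rightarrow> ('a \<Rightarrow> 'a) \<Rightarrow> 'a \<times> nat \<Rightarrow> 'a \<times> nat" where
  "lift_perm n p = (\<lambda>(u, i). if i \<in> {1..n} then (p u, i) else (u, i))"

text \<open>The index \<open>n + k - i\<close> reflects the segment from \<open>k\<close> to
  \<open>n\<close>.\<close>

definition reverse_fibre :: "nat \<Rightarrow> 'a \<Rightarrow> nat \<Rightarrow> 'a \<times> nat \<Rightarrow> 'a \<times> nat" where
  "reverse_fibre n x k = (\<lambda>(u, i). if u = x \<and> i \<in> {k..n} then (x, n + k - i) else (u, i))"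

text \<open>The index shifts by one because \<open>(y, 1)\<close>, the vertex carrying both paths,
  stays in place; \<open>(x, n)\<close> has no partner and is fixed too.\<close>

definition exchange_fibres :: "nat \<Rightarrow> 'a \<Rightarrow> 'a \<Rightarrow> 'a \<times> nat \<Rightarrow> 'a \<times> nat" where
  "exchange_fibres n x y = (\<lambda>(u, i).
     if u = x \<and> i \<in> {1..<n} then (y, i + 1) else if u = y \<and> i \<in> {2..n} then (x, i - 1) else (u, i))"

lemma lift_perm_permutes:
  assumes "p permutes V"
  shows "lift_perm n p permutes V \<times> {1..n}"
  unfolding permutes_def
proof (intro conjI allI impI)
  show "lift_perm n p a = a" if "a \<notin> V \<times> {1..n}" for a
    using that assms by (cases a) (auto simp: lift_perm_def permutes_not_in)
  show "\<exists>!b. lift_perm n p b = a" for a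
  proof
    show "lift_perm n p (lift_perm n (inv_into UNIV p) a) = a"
      using assms by (cases a) (auto simp: lift_perm_def permutes_inverses)
    show "b = lift_perm n (inv_into UNIV p) a" if "lift_perm n p b = a" for b
      using assms that by (cases b) (auto simp: lift_perm_def permutes_inverses split: if_splits)
  qed
qed

lemma lift_perm_inv:
  assumes "p permutes V"
  shows "inv_into UNIV (lift_perm n p) = lift_perm n (inv_into UNIV p)"
  using assms by (intro inv_unique_comp) (auto simp: fun_eq_iff lift_perm_def permutes_inverses)

text \<open>Path edges go to path edges of another fibre, and copies of edges of \<open>G\<close>
  occur only at level 1. Hence the only new edge is the copy of \<open>cd\<close> at that
  level.\<close>

lemma edge_switch_lift_perm:
  assumes "1 \<le> n" "edge_switch G p"
  shows "edge_switch (comb_product G (path_graph n) 1) (lift_perm n p)" (is "edge_switch ?H ?p")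
proof -
  obtain c d where cd: "\<And>a b. (p a, p b) \<in> parcs G \<Longrightarrow> (a, b) \<in> parcs G \<union> {(c, d), (d, c)}"
    using assms(2) unfolding edge_switch_def by blast
  have p: "p permutes pverts G"
    using assms(2) unfolding edge_switch_def by blast
  then have inj: "p u = p v \<longleftrightarrow> u = v" for u v
    by (simp add: permutes_inj inj_eq)
  have "(a, b) \<in> parcs ?H \<union> {((c, 1), (d, 1)), ((d, 1), (c, 1))}"
    if "(?p a, ?p b) \<in> parcs ?H" for a b
  proof -
    obtain u i v j where ab: "a = (u, i)" "b = (v, j)"
      by (metis surj_pair)
    show ?thesis
      using that assms(1) p cd[of u v] unfolding ab lift_perm_def
      by (auto simp: parcs_comb_path inj permutes_in_image split: if_splits)
  qed
  then show ?thesis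
    using lift_perm_permutes[OF p] unfolding edge_switch_def pverts_comb_path by blast
qed

lemma switch_group_lift_perm:
  fixes G :: "'a pair_pre_digraph"
  assumes "1 \<le> n" "p \<in> switch_group G"
  shows "lift_perm n p \<in> switch_group (comb_product G (path_graph n) 1)"
  using assms(2)
proof (induction rule: switch_group.induct)
  case one
  have "lift_perm n (id :: 'a \<Rightarrow> 'a) = id"
    by (auto simp: lift_perm_def)
  then show ?case
    by (simp only: switch_group.one)
next
  case (incl p)
  then show ?case
    by (intro switch_group.incl edge_switch_lift_perm assms(1))
next
  case (inv p)
  then have "p permutes pverts G"
    unfolding edge_switch_def by blast
  then show ?case
    using switch_group.inv[OF edge_switch_lift_perm[OF assms(1) inv]] by (simp only: lift_perm_inv)
next
  case (comp p q)
  have "lift_perm n (p \<circ> q) = lift_perm n p \<circ> lift_perm n q"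
    by (auto simp: lift_perm_def)
  then show ?case
    using switch_group.comp[OF comp.IH] by (simp only:)
qed

section \<open>Switches at a leaf and the transpositions they generate\<close>

context pair_graph
begin

context
  fixes x y :: 'a and n :: nat
  assumes neighbour: "\<And>u. (x, u) \<in> parcs G \<longleftrightarrow> u = y"
begin

lemma leaf_arcs: "(u, x) \<in> parcs G \<longleftrightarrow> u = y" "x \<in> pverts G" "y \<in> pverts G" "x \<noteq> y" "y \<noteq> x"
  using neighbour[of y] neighbour[of u] arcs_symmetric in_arcsD1[of x y] in_arcsD2[of x y]
    no_loops'[of x y] by blast+

text \<open>Reversal preserves the edges inside the segment and those away from it. Only the edge
  attaching the segment to the rest changes: its end \<open>(x, k)\<close> becomes
  \<open>(x, n)\<close>.\<close>

lemma edge_switch_reverse_fibre: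
  assumes "k \<in> {1..n}"
  shows "edge_switch (comb_product G (path_graph n) 1) (reverse_fibre n x k)"
    (is "edge_switch ?H ?p")
proof (rule edge_switch_involutionI)
  \<comment> \<open>The vertex to which the segment is attached: the previous one in the fibre, or
    the base neighbour if the whole fibre is reversed.\<close>
  let ?c = "if k = 1 then (y, 1) else (x, k - 1)"
  have fixed: "?p (u, i) = (u, i)" if "u \<noteq> x \<or> i < k" for u i
    using that by (auto simp: reverse_fibre_def)
  have reflected: "?p (x, i) = (x, n + k - i)" if "k \<le> i" "i \<le> n" for i
    using that by (simp add: reverse_fibre_def)
  have leaf_end: "?p (x, 1) = (if k = 1 then (x, n) else (x, 1))"
    using assms by (auto simp: reverse_fibre_def)
  have neighbour_end: "?p (y, 1) = (y, 1)"
    using fixed leaf_arcs by blast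
  have path_arcs: "((u, i), (u, Suc i)) \<in> parcs ?H" "((u, Suc i), (u, i)) \<in> parcs ?H"
    if "u \<in> pverts G" "i \<in> {1..<n}" for u i
    using that by (auto simp: parcs_comb_path)
  show "?p (?p a) = a" for a
    by (cases a) (auto simp: reverse_fibre_def)
  show "?p a = a" if "a \<notin> pverts ?H" for a
    using that assms leaf_arcs by (cases a) (auto simp: reverse_fibre_def pverts_comb_path)
  show "(?p a, ?p b) \<in> parcs ?H \<union> {(?c, (x, n)), ((x, n), ?c)}" if "(a, b) \<in> parcs ?H" for a b
  proof -
    have up: "(?p (u, i), ?p (u, Suc i)) \<in> parcs ?H \<union> {(?c, (x, n)), ((x, n), ?c)}
        \<and> (?p (u, Suc i), ?p (u, i)) \<in> parcs ?H \<union> {(?c, (x, n)), ((x, n), ?c)}"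
      if "u \<in> pverts G" "i \<in> {1..<n}" for u i
    proof -
      \<comment> \<open>The path edge avoids the segment, enters it, or lies inside it.\<close>
      consider "u \<noteq> x \<or> Suc i < k" | "u = x" "Suc i = k" | "u = x" "k \<le> i"
        by (metis less_Suc_eq_le linorder_neqE_nat)
      then show ?thesis
      proof cases
        case 1
        then have "?p (u, i) = (u, i)" "?p (u, Suc i) = (u, Suc i)"
          using fixed[of u i] fixed[of u "Suc i"] by auto
        then show ?thesis
          using path_arcs[OF that] by simp
      next
        case 2
        then have "?p (u, i) = (x, i)" "?p (u, Suc i) = (x, n)"
          using that fixed[of u i] reflected[of "Suc i"] by auto
        then show ?thesis
          using 2 that by auto
      next
        case 3
        \<comment> \<open>Reflection sends the edge at levels \<open>i\<close>, \<open>Suc i\<close>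
          to the one at levels \<open>Suc m\<close>, \<open>m\<close>.\<close>
        define m where "m = n + k - Suc i"
        have m: "n + k - i = Suc m" "m \<in> {1..<n}"
          using 3 assms that by (auto simp: m_def)
        have "?p (u, i) = (u, Suc m)" "?p (u, Suc i) = (u, m)"
          using 3 that m(1) by (simp_all add: reflected m_def)
        then show ?thesis
          using path_arcs[OF that(1) m(2)] by simp
      qed
    qed
    show ?thesis
      using that
    proof (cases rule: parcs_comb_path_cases)
      case (base u v)
      consider "u \<noteq> x" "v \<noteq> x" | "u = x" "v = y" | "u = y" "v = x"
        using base(3) neighbour leaf_arcs by blast
      then show ?thesis
      proof cases
        case 1
        then show ?thesis
          using base by (simp add: fixed parcs_comb_path)
      next
        case 2
        then show ?thesis
          unfolding base(1,2) 2 leaf_end neighbour_end using neighbour[of y]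
          by (simp add: parcs_comb_path)
      next
        case 3
        then show ?thesis
          unfolding base(1,2) 3 leaf_end neighbour_end using leaf_arcs(1)[of y]
          by (simp add: parcs_comb_path)
      qed
    qed (use up in blast)+
  qed
qed

text \<open>Without the edge from \<open>(x, n - 1)\<close> to \<open>(x, n)\<close>, two paths with
  \<open>n - 1\<close> vertices each hang at \<open>(y, 1)\<close>, and swapping them preserves all
  other edges. The cut edge becomes the one from \<open>(y, n)\<close> to
  \<open>(x, n)\<close>.\<close>

lemma edge_switch_exchange_fibres:
  assumes "2 \<le> n"
  shows "edge_switch (comb_product G (path_graph n) 1) (exchange_fibres n x y)"
    (is "edge_switch ?H ?p")
proof (rule edge_switch_involutionI)
  show "?p (?p a) = a" for a
    using leaf_arcs by (cases a) (auto simp: exchange_fibres_def)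
  show "?p a = a" if "a \<notin> pverts ?H" for a
    using that leaf_arcs by (cases a) (auto simp: exchange_fibres_def pverts_comb_path)
  show "(?p a, ?p b) \<in> parcs ?H \<union> {((x, n), (y, n)), ((y, n), (x, n))}" if "(a, b) \<in> parcs ?H" for a b
  proof -
    have up: "(?p (u, i), ?p (u, Suc i)) \<in> parcs ?H \<union> {((x, n), (y, n)), ((y, n), (x, n))}
        \<and> (?p (u, Suc i), ?p (u, i)) \<in> parcs ?H \<union> {((x, n), (y, n)), ((y, n), (x, n))}"
      if "u \<in> pverts G" "i \<in> {1..<n}" for u i
    proof -
      have "Suc i < n \<or> Suc i = n" "i = 1 \<or> 2 \<le> i"
        using that(2) by auto
      then consider "u \<noteq> x" "u \<noteq> y" | "u = x" "Suc i < n" | "u = x" "Suc i = n"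
        | "u = y" "i = 1" | "u = y" "2 \<le> i"
        by blast
      then show ?thesis
        using assms that leaf_arcs neighbour
        by cases (auto simp: exchange_fibres_def parcs_comb_path)
    qed
    show ?thesis
      using that
    proof (cases rule: parcs_comb_path_cases)
      case (base u v)
      consider "u \<noteq> x" "v \<noteq> x" | "u = x" "v = y" | "u = y" "v = x"
        using base(3) neighbour leaf_arcs by blast
      then show ?thesis
        using base assms leaf_arcs by cases (auto simp: exchange_fibres_def parcs_comb_path)
    qed (use up in blast)+
  qed
qed

text \<open>Conjugating the transposition of the last two levels by the reversal from level
  \<open>k\<close> gives the transposition of levels \<open>k\<close> and \<open>Suc k\<close>;
  these generate all others in the fibre.\<close>

lemma transpose_leaf_fibre:
  assumes "i \<in> {1..n}" "j \<in> {1..n}"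
  shows "transpose (x, i) (x, j) \<in> switch_group (comb_product G (path_graph n) 1)" (is "_ \<in> ?S")
proof -
  have rev: "reverse_fibre n x k \<in> ?S" if "k \<in> {1..n}" for k
    using that by (intro switch_group.incl edge_switch_reverse_fibre)
  have adjacent: "transpose (x, k) (x, Suc k) \<in> ?S" if k: "k \<in> {1..<n}" for k
  proof -
    \<comment> \<open>Reversing a segment of two vertices is a transposition.\<close>
    have "reverse_fibre n x (n - 1) = transpose (x, n - 1) (x, n)"
      using k by (auto simp: reverse_fibre_def transpose_def fun_eq_iff)
    moreover have "n - 1 \<in> {1..n}"
      using k by auto
    ultimately have "transpose (x, n - 1) (x, n) \<in> ?S"
      using rev[of "n - 1"] by (simp only:)
    moreover have "reverse_fibre n x k \<in> ?S"
      using k by (intro rev) auto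
    ultimately have "transpose (reverse_fibre n x k (x, n - 1)) (reverse_fibre n x k (x, n)) \<in> ?S"
      by (intro transpose_switch_group_image[of "reverse_fibre n x k"])
    moreover have "reverse_fibre n x k (x, n - 1) = (x, Suc k)" "reverse_fibre n x k (x, n) = (x, k)"
      using k by (auto simp: reverse_fibre_def)
    ultimately show ?thesis
      by (simp add: transpose_commute)
  qed
  have le: "transpose (x, i) (x, j) \<in> ?S" if "i \<le> j" "1 \<le> i" "j \<le> n" for i j
    using that
  proof (induction j rule: dec_induct)
    case base
    show ?case by (simp only: transpose_same switch_group.one)
  next
    case (step k)
    then have "transpose (x, i) (x, k) \<in> ?S"
      by simp
    moreover have "transpose (x, k) (x, Suc k) \<in> ?S"
      using step by (intro adjacent) auto
    ultimately show ?case
      by (rule transpose_switch_group_trans)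
  qed
  show ?thesis
  proof (cases "i \<le> j")
    case True
    then show ?thesis using assms le by simp
  next
    case False
    then show ?thesis
      using assms le[of j i] by (simp add: transpose_commute)
  qed
qed

text \<open>Lifts carry the transpositions in the leaf fibre to every fibre, and the exchange
  supplies one between two fibres, which lifts then carry to any two fibres.\<close>

lemma comb_path_transpose:
  assumes full: "\<And>p. p permutes pverts G \<Longrightarrow> p \<in> switch_group G"
    and ui: "u \<in> pverts G" "i \<in> {1..n}" and vj: "v \<in> pverts G" "j \<in> {1..n}"
  shows "transpose (u, i) (v, j) \<in> switch_group (comb_product G (path_graph n) 1)" (is "_ \<in> ?S")
proof -
  have lift: "lift_perm n p \<in> ?S" if "p permutes pverts G" for p
    using ui(2) full[OF that] by (intro switch_group_lift_perm) auto
  have fibre: "transpose (u, i) (u, j) \<in> ?S"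
    if "u \<in> pverts G" "i \<in> {1..n}" "j \<in> {1..n}" for u i j
  proof -
    have "lift_perm n (transpose x u) \<in> ?S"
      using that leaf_arcs by (intro lift permutes_swap_id)
    then have "transpose (lift_perm n (transpose x u) (x, i)) (lift_perm n (transpose x u) (x, j)) \<in> ?S"
      using transpose_leaf_fibre[OF that(2,3)] by (rule transpose_switch_group_image)
    then show ?thesis
      using that by (simp add: lift_perm_def)
  qed
  \<comment> \<open>For \<open>n = 1\<close> the exchange moves nothing, but there a lifted
    transposition is itself a transposition.\<close>
  consider "u = v" | "u \<noteq> v" "n = 1" | "u \<noteq> v" "2 \<le> n"
    using ui(2) by fastforce
  then show ?thesis
  proof cases
    case 1
    then show ?thesis using fibre ui vj by simp
  next
    case 2
    have "lift_perm n (transpose u v) \<in> ?S"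
      using ui vj by (intro lift permutes_swap_id)
    moreover have "lift_perm n (transpose u v) = transpose (u, i) (v, j)"
      using 2 ui vj by (auto simp: lift_perm_def transpose_def fun_eq_iff)
    ultimately show ?thesis by simp
  next
    case 3
    \<comment> \<open>The exchange moves \<open>(x, 1)\<close> to \<open>(y, 2)\<close> and fixes
      \<open>(x, n)\<close>, so conjugation takes a transposition inside the leaf fibre to one
      across fibres.\<close>
    have "exchange_fibres n x y \<in> ?S"
      using 3 by (intro switch_group.incl edge_switch_exchange_fibres)
    moreover have "transpose (x, 1) (x, n) \<in> ?S"
      using 3 by (intro transpose_leaf_fibre) auto
    ultimately have "transpose (exchange_fibres n x y (x, 1)) (exchange_fibres n x y (x, n)) \<in> ?S"
      by (rule transpose_switch_group_image)
    moreover have "exchange_fibres n x y (x, 1) = (y, 2)" "exchange_fibres n x y (x, n) = (x, n)"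
      using 3 leaf_arcs by (auto simp: exchange_fibres_def)
    ultimately have "transpose (x, n) (y, 2) \<in> ?S"
      by (simp add: transpose_commute)
    \<comment> \<open>The permutation \<open>p\<close> has to send \<open>x\<close> to
      \<open>u\<close> and \<open>y\<close> to \<open>v\<close>. The first factor sends
      \<open>y\<close> to \<open>y'\<close>; the second corrects this and fixes \<open>u\<close>,
      since \<open>u\<close> differs from \<open>y'\<close> and \<open>v\<close>.\<close>
    define y' where "y' = transpose x u y"
    define p where "p = transpose y' v \<circ> transpose x u"
    have "y' \<in> pverts G" "y' \<noteq> u"
      using leaf_arcs ui(1) by (auto simp: y'_def transpose_def)
    then have p: "p permutes pverts G" "p x = u" "p y = v"
      using leaf_arcs ui vj 3 unfolding p_def
      by (auto simp: y'_def intro: permutes_compose permutes_swap_id)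
    have "transpose (lift_perm n p (x, n)) (lift_perm n p (y, 2)) \<in> ?S"
      using lift[OF p(1)] \<open>transpose (x, n) (y, 2) \<in> ?S\<close> by (rule transpose_switch_group_image)
    then have "transpose (u, n) (v, 2) \<in> ?S"
      using 3 p by (simp add: lift_perm_def)
    moreover have "transpose (u, i) (u, n) \<in> ?S" "transpose (v, 2) (v, j) \<in> ?S"
      using 3 ui vj fibre[of u i n] fibre[of v 2 j] by simp_all
    \<comment> \<open>Chain through \<open>(u, i)\<close>, \<open>(u, n)\<close>,
      \<open>(v, 2)\<close>, \<open>(v, j)\<close>.\<close>
    ultimately show ?thesis
      by (blast intro: transpose_switch_group_trans)
  qed
qed

end

end

text \<open>Reflecting the path moves the root from \<open>1\<close> to \<open>n\<close>.\<close>

lemma comb_path_transpose_last_root: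
  assumes first: "\<And>u i v j. u \<in> pverts G \<Longrightarrow> i \<in> {1..n} \<Longrightarrow> v \<in> pverts G \<Longrightarrow> j \<in> {1..n} \<Longrightarrow>
      transpose (u, i) (v, j) \<in> switch_group (comb_product G (path_graph n) 1)"
    and ui: "u \<in> pverts G" "i \<in> {1..n}" and vj: "v \<in> pverts G" "j \<in> {1..n}"
  shows "transpose (u, i) (v, j) \<in> switch_group (comb_product G (path_graph n) n)"
proof -
  let ?H = "comb_product G (path_graph n) 1" and ?H' = "comb_product G (path_graph n) n"
  \<comment> \<open>The index \<open>n + 1 - i\<close> swaps the two ends of each fibre. Being the
    identity on other levels, \<open>f\<close> is an involution of the whole type, as the transport
    of switch groups requires a global bijection.\<close>
  define f :: "'a \<times> nat \<Rightarrow> 'a \<times> nat"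
    where "f = (\<lambda>(u, i). if i \<in> {1..n} then (u, n + 1 - i) else (u, i))"
  have inv: "f (f a) = a" for a
    by (cases a) (auto simp: f_def)
  then have bij: "bij f"
    by (intro involuntory_imp_bij)
  have arcs: "(a, b) \<in> parcs ?H' \<longleftrightarrow> (f a, f b) \<in> parcs ?H" for a b
    using ui(2) by (cases a; cases b) (auto simp: f_def parcs_comb_path)
  have verts: "a \<in> pverts ?H' \<longleftrightarrow> f a \<in> pverts ?H" for a
    by (cases a) (auto simp: f_def pverts_comb_path)
  have "pverts ?H' = f ` pverts ?H"
  proof (intro equalityI subsetI)
    fix a assume "a \<in> pverts ?H'"
    then show "a \<in> f ` pverts ?H"
      by (intro image_eqI[of _ _ "f a"]) (simp_all only: verts inv)
  next
    fix a assume "a \<in> f ` pverts ?H"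
    then show "a \<in> pverts ?H'"
      by (elim imageE) (simp only: verts inv)
  qed
  moreover have "parcs ?H' = map_prod f f ` parcs ?H"
  proof (intro equalityI subsetI)
    fix e assume "e \<in> parcs ?H'"
    then show "e \<in> map_prod f f ` parcs ?H"
      using arcs[of "fst e" "snd e"]
      by (intro image_eqI[of _ _ "(f (fst e), f (snd e))"]) (simp_all add: inv)
  next
    fix e assume "e \<in> map_prod f f ` parcs ?H"
    then obtain a b where "e = (f a, f b)" "(a, b) \<in> parcs ?H"
      by auto
    then show "e \<in> parcs ?H'"
      by (simp only: arcs inv)
  qed
  ultimately have transport: "f \<circ> p \<circ> inv_into UNIV f \<in> switch_group ?H'" if "p \<in> switch_group ?H" for p
    using that bij by (intro switch_group_transport)
  \<comment> \<open>The known transposition is taken at the reflected levels, which \<open>f\<close>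
    returns to \<open>i\<close> and \<open>j\<close>.\<close>
  have "n + 1 - i \<in> {1..n}" "n + 1 - j \<in> {1..n}"
    using ui(2) vj(2) by auto
  then have "transpose (u, n + 1 - i) (v, n + 1 - j) \<in> switch_group ?H"
    using ui(1) vj(1) by (intro first)
  then have "transpose (f (u, i)) (f (v, j)) \<in> switch_group ?H"
    using ui(2) vj(2) by (simp add: f_def)
  from transport[OF this] show ?thesis
    by (simp only: transpose_conj[OF bij] inv)
qed

theorem theorem3:
  fixes G :: "'a pair_pre_digraph" and lab :: "'a \<Rightarrow> 'b" and X :: "'b set"
    and n root :: nat
    and lab' :: "'a \<times> nat \<Rightarrow> 'c" and Y :: "'c set"
  assumes "local_amoeba G lab X"
    and "\<exists>x. leaf G x"
    and "n \<ge> 1"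
    and "if n = 1 then root \<in> pverts (path_graph n) else leaf (path_graph n) root"
    and "bij_betw lab' (pverts (comb_product G (path_graph n) root)) Y"
  shows "local_amoeba (comb_product G (path_graph n) root) lab' Y"
proof -
  let ?H = "comb_product G (path_graph n)"
  have "labeled_graph G lab X" and full: "\<And>p. p permutes pverts G \<Longrightarrow> p \<in> switch_group G"
    using assms(1) by (simp_all add: local_amoeba_iff)
  then interpret labeled_graph G lab X by simp
  obtain x y where xy: "\<And>u. (x, u) \<in> parcs G \<longleftrightarrow> u = y"
    using assms(2) leaf_unique_neighbour by metis
  have root: "root = 1 \<or> root = n"
    using assms(4) leaf_path_graphD by (auto simp: path_graph_def split: if_splits)
  then have "root \<in> {1..n}"
    using assms(3) by auto
  then interpret H: pair_graph "?H root"
    by (intro pair_graph_comb_path pair_graph)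
  have first: "transpose (u, i) (v, j) \<in> switch_group (?H 1)"
    if "u \<in> pverts G" "i \<in> {1..n}" "v \<in> pverts G" "j \<in> {1..n}" for u i v j
    using comb_path_transpose[OF xy full that] .
  have transposes: "transpose a b \<in> switch_group (?H root)"
    if "a \<in> pverts (?H root)" "b \<in> pverts (?H root)" for a b
    using root
  proof
    assume "root = 1"
    then show ?thesis
      using that first by (auto simp: pverts_comb_path)
  next
    assume "root = n"
    then show ?thesis
      using that comb_path_transpose_last_root[OF first] by (auto simp: pverts_comb_path)
  qed
  have "p \<in> switch_group (?H root)" if "p permutes pverts (?H root)" for p
    using switch_group_full[OF H.pair_finite_verts transposes that] .
  \<comment> \<open>The new labeling enters only here; membership in \<open>switch_group\<close>
    concerns vertices alone.\<close>
  moreover have "labeled_graph (?H root) lab' Y"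
    using assms(5) by unfold_locales
  ultimately show ?thesis
    by (simp add: local_amoeba_iff)
qed

end
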